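(* For every integer $n\geqslant 1$, $$C_n(x)=nxC_{n-1}(x)+\sum_{r=1}^{n-1}\binom{n}{n-r+1}C_{n-r}(x)C_{r-1}(x).$$ When $x=1$ this reduces to $$(2n-1)!!=n\,(2n-3)!!+\sum_{r=1}^{n-1}\binom{n}{n-r+1}(2n-2r-1)!!\,(2r-3)!!,$$ with the convention $(-1)!!=1$.
   Context: For $n\geqslant 1$, $\mathcal{Q}_n$ denotes the set of Stirling permutations of the multiset $\{1,1,2,2,\ldots,n,n\}$, i.e. words $\sigma=\sigma_1\cdots\sigma_{2n}$ using each of $1,\ldots,n$ exactly twice such that for each $i$ all letters between the two occurrences of $i$ are at least $i$. Set $\sigma_0=\sigma_{2n+1}=0$, and let ${\rm des}(\sigma)=\#\{i\in\{0,1,\ldots,2n\}:\sigma_i>\sigma_{i+1}\}$. The second-order Eulerian polynomials are $C_n(x)=\sum_{\sigma\in\mathcal{Q}_n}x^{{\rm des}(\sigma)}$ for $n\geqslant1$, and $C_0(x)=1$. One has $C_n(1)=(2n-1)!!$. *)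

theory Defs
  imports "HOL-Computational_Algebra.Polynomial" "HOL-Library.Multiset"
begin

definition stirling_perms :: "nat \<Rightarrow> nat list set" where
  "stirling_perms n =
     {w. mset w = mset_set {1..n} + mset_set {1..n} \<and>
         (\<forall>i j k. i < j \<and> j < k \<and> k < length w \<and> w ! i = w ! k \<longrightarrow> w ! i \<le> w ! j)}"

(* The word is padded by 0 on both sides, so that the descent at the right end is counted;
   position i of the padded word carries the letter sigma_i of the 1-based word. *)
definition des :: "nat list \<Rightarrow> nat" where
  "des w = (let s = 0 # w @ [0] in card {i \<in> {0..length w}. s ! i > s ! (i + 1)})"

definition second_eulerian_poly :: "nat \<Rightarrow> int poly" where
  "second_eulerian_poly n =
     (if n = 0 then 1 else (\<Sum>w\<in>stirling_perms n. [:0, 1:] ^ des w))"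

(* Integer argument, so that 2n - 3 does not truncate at n = 1;
   the product is empty for k = -1, giving (-1)!! = 1. *)
definition double_fact :: "int \<Rightarrow> int" where
  "double_fact k = \<Prod>{i \<in> {1..k}. even (k - i)}"

end

theory Submission
  imports Defs
begin

text \<open>
  Inserting the adjacent pair of letters n+1 into one of the 2n+1 slots of a word in Q_n keeps the
  number of descents if the slot is a descent and raises it by one otherwise.  Hence
  C_(n+1) = (2n+1) x C_n + x (1-x) C_n'.
  Let u_0 = 1, u_1 = -x and u_k = -C_(k-1) for k > 1.  The claim says that the binomial convolution
  h_n of u and C vanishes for n > 0, that is, that the exponential generating functions of u and C
  are reciprocal.  The recurrence for C gives
  u_(k+1) = (2k-1) x u_k + x (1-x) u_k'.  In the recurrence for h obtained from these two by the
  product rule the terms x and -x cancel, so that h_(n+1) = 2n x h_n + x (1-x) h_n'.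
  As h_0 = 1, this yields h_1 = 0, and then h_n = 0 for all n > 0.
\<close>

section \<open>Inserting the largest letter\<close>

definition insert_pair :: "nat \<Rightarrow> 'a \<Rightarrow> 'a list \<Rightarrow> 'a list" where
  "insert_pair i m w = take i w @ m # m # drop i w"

lemma length_insert_pair [simp]: "length (insert_pair i m w) = length w + 2"
  by (simp add: insert_pair_def)

lemma mset_insert_pair: "mset (insert_pair i m w) = {#m, m#} + mset w"
proof -
  have "mset w = mset (take i w) + mset (drop i w)"
    by (metis append_take_drop_id mset_append)
  then show ?thesis by (simp add: insert_pair_def)
qed

lemma nth_insert_pair:
  assumes "i \<le> length w"
  shows "insert_pair i m w ! p =
    (if p < i then w ! p else if p \<le> i + 1 then m else w ! (p - 2))"
proof -
  consider "p < i" | "p = i" | "p = i + 1" | q where "p = i + 2 + q"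
    by (metis Suc_eq_plus1 add_2_eq_Suc' less_Suc_eq not_less_eq less_iff_Suc_add add_Suc add_Suc_right)
  then show ?thesis
    using assms by cases (auto simp: insert_pair_def nth_append min_def)
qed

definition stirling_word :: "'a::linorder list \<Rightarrow> bool" where
  "stirling_word w \<longleftrightarrow>
     (\<forall>i j k. i < j \<and> j < k \<and> k < length w \<and> w ! i = w ! k \<longrightarrow> w ! i \<le> w ! j)"

lemma stirling_wordD:
  "stirling_word w \<Longrightarrow> i < j \<Longrightarrow> j < k \<Longrightarrow> k < length w \<Longrightarrow> w ! i = w ! k \<Longrightarrow> w ! i \<le> w ! j"
  unfolding stirling_word_def by blast

text \<open>The letter \<open>m\<close> exceeds all letters of \<open>w\<close>, so it is harmless
  between two equal letters; as outer letters its two copies are adjacent and enclose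
  nothing.\<close>

lemma stirling_word_insert_pair_iff:
  assumes "i \<le> length w" and less: "\<And>a. a \<in> set w \<Longrightarrow> a < m"
  shows "stirling_word (insert_pair i m w) \<longleftrightarrow> stirling_word w"
proof
  let ?v = "insert_pair i m w"
  assume v: "stirling_word ?v"
  \<comment> \<open>\<open>g\<close> gives the place of each old letter after the insertion. It is
    increasing, so every pattern in \<open>w\<close> reappears in the longer word.\<close>
  define g where "g p = (if p < i then p else p + 2)" for p
  have g: "?v ! g p = w ! p" for p
    using assms(1) by (simp add: nth_insert_pair g_def)
  show "stirling_word w"
    unfolding stirling_word_def
  proof (intro allI impI)
    fix a b c
    assume *: "a < b \<and> b < c \<and> c < length w \<and> w ! a = w ! c"
    then have "g a < g b" "g b < g c" "g c < length ?v" "?v ! g a = ?v ! g c"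
      by (auto simp: g) (auto simp: g_def)
    then have "?v ! g a \<le> ?v ! g b" using stirling_wordD[OF v] by blast
    then show "w ! a \<le> w ! b" by (simp add: g)
  qed
next
  let ?v = "insert_pair i m w"
  assume w: "stirling_word w"
  define f where "f p = (if p < i then p else p - 2)" for p
  have f: "?v ! p = w ! f p" "f p < length w" if "p \<noteq> i" "p \<noteq> i + 1" "p < length ?v" for p
    using that assms(1) by (auto simp: nth_insert_pair f_def)
  have m: "?v ! p = m \<longleftrightarrow> p = i \<or> p = i + 1" if "p < length ?v" for p
  proof (cases "p = i \<or> p = i + 1")
    case True
    then show ?thesis using assms(1) by (auto simp: nth_insert_pair)
  next
    case False
    then have "?v ! p < m" using f[of p] that less nth_mem by auto
    then show ?thesis using False by auto
  qed
  have le: "?v ! p \<le> m" if "p < length ?v" for p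
    using that m[of p] f[of p] less[OF nth_mem[of "f p" w]] by fastforce
  show "stirling_word ?v"
    unfolding stirling_word_def
  proof (intro allI impI)
    fix a b c
    assume *: "a < b \<and> b < c \<and> c < length ?v \<and> ?v ! a = ?v ! c"
    then have len: "a < length ?v" "b < length ?v" "c < length ?v" by linarith+
    show "?v ! a \<le> ?v ! b"
    proof (cases "b = i \<or> b = i + 1")
      case True
      then show ?thesis using le[OF len(1)] m[OF len(2)] by simp
    next
      case b: False
      \<comment> \<open>If one outer position were new, equality of the letters would make both new,
        and nothing lies strictly between \<open>i\<close> and \<open>i + 1\<close>.\<close>
      have ac: "a \<noteq> i" "a \<noteq> i + 1" "c \<noteq> i" "c \<noteq> i + 1"
        using * m[OF len(1)] m[OF len(3)] by auto
      have "f a < f b" "f b < f c"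
        using * b ac by (auto simp: f_def)
      moreover have "w ! f a = w ! f c"
        using * f[of a] f[of c] ac len by simp
      ultimately have "w ! f a \<le> w ! f b"
        using stirling_wordD[OF w, of "f a" "f b" "f c"] f(2)[of c] ac len by blast
      then show ?thesis using f(1)[of a] f(1)[of b] ac b len by simp
    qed
  qed
qed

text \<open>A letter between the two copies of the maximum \<open>m\<close> would be at least
  \<open>m\<close>, hence a third copy of \<open>m\<close>.\<close>

lemma stirling_word_max_adjacent:
  assumes w: "stirling_word w" and cnt: "count (mset w) m = 2"
    and le: "\<And>a. a \<in> set w \<Longrightarrow> a \<le> m"
  obtains xs ys where "w = xs @ m # m # ys" "m \<notin> set xs" "m \<notin> set ys"
proof -
  have "m \<in> set w" using cnt by (metis count_mset_0_iff zero_neq_numeral)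
  then obtain xs r where r: "w = xs @ m # r" "m \<notin> set xs"
    using split_list_first by metis
  then have c: "count (mset r) m = 1"
    using cnt by (simp add: count_mset_0_iff[THEN iffD2])
  then have "m \<in> set r" by (metis count_mset_0_iff zero_neq_one)
  then obtain zs ys where z: "r = zs @ m # ys" "m \<notin> set zs"
    using split_list_first by metis
  then have y: "m \<notin> set ys" using c count_mset_0_iff[of ys m] by simp
  have "zs = []"
  proof (rule ccontr)
    assume "zs \<noteq> []"
    then obtain b zs' where b: "zs = b # zs'" by (cases zs) auto
    have "w ! length xs \<le> w ! (length xs + 1)"
      by (rule stirling_wordD[OF w, of _ _ "length xs + 1 + length zs"])
        (auto simp: r z b nth_append)
    then have "m \<le> b" by (simp add: r z b nth_append)
    then show False using le[of b] z(2) by (auto simp: r(1) z(1) b)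
  qed
  then show ?thesis using that r z y by simp
qed

section \<open>Stirling permutations of order n+1 from those of order n\<close>

lemma stirling_perms_iff:
  "w \<in> stirling_perms n \<longleftrightarrow> mset w = mset_set {1..n} + mset_set {1..n} \<and> stirling_word w"
  by (simp add: stirling_perms_def stirling_word_def)

lemma set_stirling_perms:
  assumes "w \<in> stirling_perms n"
  shows "set w = {1..n}"
proof -
  have "set_mset (mset w) = {1..n}" using assms by (simp add: stirling_perms_iff)
  then show ?thesis by simp
qed

lemma length_stirling_perms:
  assumes "w \<in> stirling_perms n"
  shows "length w = 2 * n"
proof -
  have "size (mset w) = 2 * n" using assms by (simp add: stirling_perms_iff)
  then show ?thesis by simp
qed

lemma mset_set_atLeast1_Suc: "mset_set {Suc 0..Suc n} = add_mset (Suc n) (mset_set {Suc 0..n})"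
  by (simp add: atLeastAtMostSuc_conv)

lemma insert_pair_stirling_perms:
  assumes "w \<in> stirling_perms n" "i \<le> 2 * n"
  shows "insert_pair i (Suc n) w \<in> stirling_perms (Suc n)"
proof -
  have "stirling_word (insert_pair i (Suc n) w)"
    using assms stirling_word_insert_pair_iff[of i w "Suc n"]
    by (auto simp: length_stirling_perms set_stirling_perms stirling_perms_iff[of w])
  then show ?thesis
    using assms by (simp add: stirling_perms_iff mset_insert_pair mset_set_atLeast1_Suc)
qed

text \<open>Word and slot can both be read off the result, which makes the insertion
  injective.\<close>

lemma insert_pair_inverse:
  assumes "m \<notin> set w" "i \<le> length w"
  shows "filter (\<lambda>a. a \<noteq> m) (insert_pair i m w) = w"
    and "length (takeWhile (\<lambda>a. a \<noteq> m) (insert_pair i m w)) = i"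
proof -
  have ne: "\<forall>a\<in>set w. a \<noteq> m" using assms(1) by blast
  have id: "filter (\<lambda>a. a \<noteq> m) v = v" if "set v \<subseteq> set w" for v
    using that ne by (auto intro: filter_True)
  show "filter (\<lambda>a. a \<noteq> m) (insert_pair i m w) = w"
    using id[OF set_take_subset] id[OF set_drop_subset] by (simp add: insert_pair_def)
  show "length (takeWhile (\<lambda>a. a \<noteq> m) (insert_pair i m w)) = i"
    using assms ne by (subst insert_pair_def, subst takeWhile_append2) (auto dest: in_set_takeD)
qed

text \<open>Injectivity holds because \<open>?g\<close> undoes the insertion. For surjectivity, the
  two copies of the largest letter are adjacent, and deleting them leaves a Stirling
  permutation.\<close>

lemma bij_betw_insert_pair:
  "bij_betw (\<lambda>(w, i). insert_pair i (Suc n) w) (stirling_perms n \<times> {0..2 * n})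
     (stirling_perms (Suc n))"
proof (rule bij_betwI')
  let ?g = "\<lambda>v. (filter (\<lambda>a. a \<noteq> Suc n) v, length (takeWhile (\<lambda>a. a \<noteq> Suc n) v))"
  fix p q
  assume pq: "p \<in> stirling_perms n \<times> {0..2 * n}" "q \<in> stirling_perms n \<times> {0..2 * n}"
  have g: "?g (case p of (w, i) \<Rightarrow> insert_pair i (Suc n) w) = p"
    if "p \<in> stirling_perms n \<times> {0..2 * n}" for p
    using that insert_pair_inverse[of "Suc n" "fst p" "snd p"]
    by (auto simp: length_stirling_perms set_stirling_perms)
  show "((case p of (w, i) \<Rightarrow> insert_pair i (Suc n) w) =
      (case q of (w, i) \<Rightarrow> insert_pair i (Suc n) w)) = (p = q)"
    using g[OF pq(1)] g[OF pq(2)] by metis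
next
  fix p assume "p \<in> stirling_perms n \<times> {0..2 * n}"
  then show "(case p of (w, i) \<Rightarrow> insert_pair i (Suc n) w) \<in> stirling_perms (Suc n)"
    by (auto intro: insert_pair_stirling_perms)
next
  fix v assume v: "v \<in> stirling_perms (Suc n)"
  then have "stirling_word v" "count (mset v) (Suc n) = 2"
    by (auto simp: stirling_perms_iff mset_set_atLeast1_Suc)
  moreover have "\<And>a. a \<in> set v \<Longrightarrow> a \<le> Suc n" using set_stirling_perms[OF v] by auto
  ultimately obtain xs ys
    where xy: "v = xs @ Suc n # Suc n # ys" "Suc n \<notin> set xs" "Suc n \<notin> set ys"
    by (rule stirling_word_max_adjacent)
  then have eq: "v = insert_pair (length xs) (Suc n) (xs @ ys)"
    by (simp add: insert_pair_def)
  have lt: "a < Suc n" if "a \<in> set (xs @ ys)" for a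
  proof -
    have "a \<in> set v" "a \<noteq> Suc n" using that xy by auto
    then show ?thesis using set_stirling_perms[OF v] by simp
  qed
  have "stirling_word (xs @ ys)"
    using v lt stirling_word_insert_pair_iff[of "length xs" "xs @ ys" "Suc n"]
    by (auto simp: stirling_perms_iff eq)
  moreover have "mset (xs @ ys) = mset_set {1..n} + mset_set {1..n}"
    using v by (simp add: stirling_perms_iff mset_set_atLeast1_Suc xy)
  ultimately have xsys: "xs @ ys \<in> stirling_perms n" by (simp add: stirling_perms_iff)
  then have "length xs \<le> 2 * n" using length_stirling_perms[OF xsys] by simp
  then show "\<exists>p\<in>stirling_perms n \<times> {0..2 * n}. v = (case p of (w, i) \<Rightarrow> insert_pair i (Suc n) w)"
    using xsys eq by (intro bexI[of _ "(xs @ ys, length xs)"]) auto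
qed

section \<open>Descents\<close>

text \<open>No zeros are added here; the argument is the word already padded. The recursive form
  makes it easy to split the count at a letter.\<close>

fun descents :: "nat list \<Rightarrow> nat" where
  "descents (a # b # xs) = (if b < a then 1 else 0) + descents (b # xs)"
| "descents _ = 0"

text \<open>The letter \<open>a\<close> is kept on both sides of the cut, so that no adjacent pair
  is lost or counted twice.\<close>

lemma descents_append: "descents (xs @ a # ys) = descents (xs @ [a]) + descents (a # ys)"
  by (induction xs rule: descents.induct) (auto simp: neq_Nil_conv Cons_eq_append_conv)

lemma card_descents: "card {i \<in> {0..<length s - 1}. s ! i > s ! (i + 1)} = descents s"
proof (induction s rule: descents.induct)
  case (1 a b xs)
  let ?D = "\<lambda>s::nat list. {i \<in> {0..<length s - 1}. s ! i > s ! (i + 1)}"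
  \<comment> \<open>Descents of the tail, shifted by one position; only position 0 remains to be
    treated.\<close>
  define E where "E = Suc ` ?D (b # xs)"
  have D: "?D (a # b # xs) = (if b < a then {0} else {}) \<union> E"
  proof (rule set_eqI)
    fix i
    show "i \<in> ?D (a # b # xs) \<longleftrightarrow> i \<in> (if b < a then {0} else {}) \<union> E"
      by (cases i) (auto simp: E_def image_iff)
  qed
  have "card E = descents (b # xs)" "finite E" "0 \<notin> E"
    using 1 by (auto simp: E_def card_image)
  then show ?case unfolding D by simp
qed auto

lemma des_eq_descents: "des w = descents (0 # w @ [0])"
  using card_descents[of "0 # w @ [0]"]
  by (simp add: des_def Let_def atLeastLessThanSuc_atLeastAtMost)

text \<open>The neighbours a, b of the slot become a, m, m, b, which is an ascent, a plateau and a
  descent. So exactly one descent stands where there was one or none. Positivity of \<open>m\<close>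
  covers the slots next to a padding zero.\<close>

lemma des_insert_pair:
  assumes i: "i \<le> length w" and less: "\<And>a. a \<in> set w \<Longrightarrow> a < m" and "0 < m"
  shows "des (insert_pair i m w) =
    (if (0 # w @ [0]) ! i > (0 # w @ [0]) ! (i + 1) then des w else Suc (des w))"
proof -
  define s where "s = 0 # w @ [0]"
  define xs ys where "xs = take i s" and "ys = drop (i + 2) s"
  define a b where "a = s ! i" and "b = s ! (i + 1)"
  have il: "i + 1 < length s" using i by (simp add: s_def)
  have s: "s = xs @ a # b # ys"
    unfolding xs_def ys_def a_def b_def
    using il id_take_nth_drop[of i s] Cons_nth_drop_Suc[of "i + 1" s] by simp
  have len: "length xs = i" using il by (simp add: xs_def)
  \<comment> \<open>The leading zero shifts positions by one, so slot \<open>i\<close> of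
    \<open>w\<close> lies between entries \<open>i\<close> and \<open>i + 1\<close> of
    \<open>s\<close>.\<close>
  have split: "0 # take i w = xs @ [a]" "drop i w @ [0] = b # ys"
  proof -
    have "0 # take i w = take (Suc i) s" using i by (simp add: s_def)
    also have "\<dots> = xs @ [a]" by (simp add: s len)
    finally show "0 # take i w = xs @ [a]" .
    have "drop i w @ [0] = drop (Suc i) s" using i by (simp add: s_def)
    also have "\<dots> = b # ys" by (simp add: s len)
    finally show "drop i w @ [0] = b # ys" .
  qed
  have set_s: "set s \<subseteq> insert 0 (set w)" by (auto simp: s_def)
  have "a < m" "b < m" using less \<open>0 < m\<close> set_s unfolding s by auto
  have "0 # insert_pair i m w @ [0] = (0 # take i w) @ m # m # (drop i w @ [0])"
    by (simp add: insert_pair_def)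
  also have "\<dots> = xs @ a # m # m # b # ys" by (simp add: split)
  finally have "des (insert_pair i m w) = descents (xs @ [a]) + descents (a # m # m # b # ys)"
    by (simp only: des_eq_descents descents_append[of xs a "m # m # b # ys"])
  moreover have "des w = descents (xs @ [a]) + descents (a # b # ys)"
    unfolding des_eq_descents s_def[symmetric] s by (rule descents_append)
  ultimately show ?thesis
    unfolding s_def[symmetric] a_def[symmetric] b_def[symmetric]
    using \<open>a < m\<close> \<open>b < m\<close> by simp
qed

section \<open>The differential recurrence\<close>

text \<open>At 0 the convention agrees with the sum: the empty word is the only one and has no
  descent. The recurrence can thus start at 0.\<close>

lemma second_eulerian_poly_eq_sum:
  "second_eulerian_poly n = (\<Sum>w\<in>stirling_perms n. [:0, 1:] ^ des w)"
proof (cases "n = 0")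
  case True
  have "stirling_perms 0 = {[]}" by (auto simp: stirling_perms_def)
  then show ?thesis using True by (simp add: second_eulerian_poly_def des_eq_descents)
qed (simp add: second_eulerian_poly_def)

lemma second_eulerian_poly_0: "second_eulerian_poly 0 = 1"
  by (simp add: second_eulerian_poly_def)

lemma pderiv_sum: "pderiv (\<Sum>i\<in>A. f i) = (\<Sum>i\<in>A. pderiv (f i))"
  using higher_pderiv_sum[of 1 f A] by simp

text \<open>The Euler operator turns the number of descents, which enters as a coefficient, into a
  derivative.\<close>

lemma X_pderiv_X_power:
  "[:0, 1:] * pderiv ([:0, 1:] ^ d) = of_nat d * ([:0, 1:] ^ d :: 'a::idom poly)"
proof (cases d)
  case (Suc k)
  have "pderiv [:0, 1:] = (1 :: 'a poly)" by (simp add: pderiv_pCons)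
  moreover have "smult (of_nat d) p = of_nat d * p" for p :: "'a poly"
    by (simp add: of_nat_poly)
  ultimately show ?thesis
    unfolding Suc pderiv_power_Suc by (simp only: power_Suc mult_1_right mult.left_commute)
qed simp

text \<open>With d descents among the 2n+1 slots the sum is d x^d + (2n+1-d) x^(d+1). The terms with
  factor d combine to (1-x) d x^d, which is x (1-x) times the derivative of x^d.\<close>

lemma sum_insert_pair:
  fixes X :: "int poly"
  assumes w: "w \<in> stirling_perms n" and X: "X = [:0, 1:]"
  shows "(\<Sum>i = 0..2 * n. X ^ des (insert_pair i (Suc n) w)) =
    of_nat (2 * n + 1) * X * X ^ des w + X * (1 - X) * pderiv (X ^ des w)"
proof -
  let ?P = "\<lambda>i. (0 # w @ [0]) ! i > (0 # w @ [0]) ! (i + 1)"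
  define d where "d = des w"
  let ?A = "{i \<in> {0..2 * n}. ?P i}"
  have d: "card ?A = d"
    using length_stirling_perms[OF w] by (simp add: des_def d_def Let_def)
  have subA: "?A \<subseteq> {0..2 * n}" by blast
  have "card {0..2 * n} = card ?A + card ({0..2 * n} - ?A)"
    by (rule card_Int_Diff[of "{0..2 * n}" ?A, unfolded Int_absorb1[OF subA]]) simp
  then have c: "card ({0..2 * n} - ?A) + d = 2 * n + 1" using d by simp
  \<comment> \<open>Passing to \<open>int poly\<close> makes the difference a genuine one instead of
    a truncated one.\<close>
  have c': "of_nat (card ({0..2 * n} - ?A)) = of_nat (2 * n + 1) - (of_nat d :: int poly)"
    unfolding c[symmetric] by (simp only: of_nat_add add_diff_cancel_right')
  have "(\<Sum>i = 0..2 * n. X ^ des (insert_pair i (Suc n) w)) =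
      (\<Sum>i = 0..2 * n. if ?P i then X ^ d else X ^ Suc d)"
    using w by (intro sum.cong refl)
      (subst des_insert_pair, auto simp: length_stirling_perms set_stirling_perms d_def)
  also have "\<dots> = (\<Sum>i\<in>?A. X ^ d) + (\<Sum>i\<in>{0..2 * n} - ?A. X ^ Suc d)"
  proof -
    have "{0..2 * n} \<inter> {i. ?P i} = ?A" "{0..2 * n} \<inter> - {i. ?P i} = {0..2 * n} - ?A" by blast+
    then show ?thesis by (simp only: sum.If_cases finite_atLeastAtMost)
  qed
  also have "\<dots> = of_nat d * X ^ d + (of_nat (2 * n + 1) - of_nat d) * X ^ Suc d"
    by (simp only: sum_constant d c')
  also have "\<dots> = of_nat (2 * n + 1) * X * X ^ d + (1 - X) * (of_nat d * X ^ d)"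
    by (simp add: algebra_simps)
  also have "of_nat d * X ^ d = X * pderiv (X ^ d)"
    by (simp only: X X_pderiv_X_power)
  finally show ?thesis by (simp add: d_def algebra_simps)
qed

lemma second_eulerian_poly_Suc:
  fixes X :: "int poly"
  assumes X: "X = [:0, 1:]"
  shows "second_eulerian_poly (Suc n) =
    of_nat (2 * n + 1) * X * second_eulerian_poly n
    + X * (1 - X) * pderiv (second_eulerian_poly n)"
proof -
  have "second_eulerian_poly (Suc n) =
      (\<Sum>(w, i)\<in>stirling_perms n \<times> {0..2 * n}. X ^ des (insert_pair i (Suc n) w))"
    unfolding second_eulerian_poly_eq_sum X
    by (subst sum.reindex_bij_betw[OF bij_betw_insert_pair, symmetric])
      (simp add: case_prod_unfold)
  also have "\<dots> = (\<Sum>w\<in>stirling_perms n. \<Sum>i = 0..2 * n. X ^ des (insert_pair i (Suc n) w))"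
    by (simp add: sum.cartesian_product)
  also have "\<dots> = (\<Sum>w\<in>stirling_perms n.
      of_nat (2 * n + 1) * X * X ^ des w + X * (1 - X) * pderiv (X ^ des w))"
    by (intro sum.cong refl sum_insert_pair X)
  also have "\<dots> = of_nat (2 * n + 1) * X * (\<Sum>w\<in>stirling_perms n. X ^ des w)
      + X * (1 - X) * pderiv (\<Sum>w\<in>stirling_perms n. X ^ des w)"
    by (simp only: sum.distrib sum_distrib_left pderiv_sum)
  finally show ?thesis by (simp add: second_eulerian_poly_eq_sum X)
qed

section \<open>The binomial convolution\<close>

text \<open>This is n! times the coefficient of t^n in the product of the exponential generating
  functions of \<open>a\<close> and \<open>b\<close>.\<close>

definition binomial_conv :: "(nat \<Rightarrow> 'a::comm_semiring_1) \<Rightarrow> (nat \<Rightarrow> 'a) \<Rightarrow> nat \<Rightarrow> 'a" where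
  "binomial_conv a b n = (\<Sum>k\<le>n. of_nat (n choose k) * a k * b (n - k))"

text \<open>The Leibniz rule (AB)' = A'B + AB' for exponential generating functions; on coefficients
  it is Pascal's rule.\<close>

lemma binomial_conv_Suc:
  "binomial_conv a b (Suc n) =
     (\<Sum>k\<le>n. of_nat (n choose k) * (a (Suc k) * b (n - k) + a k * b (Suc (n - k))))"
proof -
  have "binomial_conv a b (Suc n) =
      a 0 * b (Suc n) + (\<Sum>k\<le>n. of_nat (Suc n choose Suc k) * a (Suc k) * b (n - k))"
    unfolding binomial_conv_def by (subst sum.atMost_Suc_shift) simp
  also have "\<dots> = (\<Sum>k\<le>n. of_nat (n choose k) * a (Suc k) * b (n - k))
      + (a 0 * b (Suc n) + (\<Sum>k\<le>n. of_nat (n choose Suc k) * a (Suc k) * b (n - k)))"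
    by (simp add: sum.distrib distrib_right distrib_left add_ac)
  \<comment> \<open>The isolated term is the summand for k = 0 after the index shift. The summand
    for k = n+1 vanishes later, as its binomial coefficient is 0.\<close>
  also have "a 0 * b (Suc n) + (\<Sum>k\<le>n. of_nat (n choose Suc k) * a (Suc k) * b (n - k)) =
      (\<Sum>k\<le>Suc n. of_nat (n choose k) * a k * b (Suc n - k))"
    by (subst sum.atMost_Suc_shift) simp
  also have "\<dots> = (\<Sum>k\<le>n. of_nat (n choose k) * a k * b (Suc (n - k)))"
    by (simp add: Suc_diff_le binomial_eq_0)
  finally show ?thesis by (simp add: sum.distrib distrib_left mult_ac)
qed

text \<open>In each summand the weights k and n-k add up to n, the derivatives merge by the product
  rule, and the terms with \<open>c\<close> and \<open>- c\<close> cancel.\<close>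

lemma binomial_conv_pderiv_recurrence:
  fixes a b :: "nat \<Rightarrow> 'a::idom poly"
  assumes a: "\<And>k. a (Suc k) = of_nat k * p * a k + q * pderiv (a k) - c * a k"
    and b: "\<And>k. b (Suc k) = of_nat k * p * b k + q * pderiv (b k) + c * b k"
  shows "binomial_conv a b (Suc n) =
    of_nat n * p * binomial_conv a b n + q * pderiv (binomial_conv a b n)"
proof -
  have d: "pderiv (of_nat m * f) = of_nat m * pderiv f" for m and f :: "'a poly"
    by (simp add: pderiv_mult)
  have "binomial_conv a b (Suc n) =
      (\<Sum>k\<le>n. of_nat n * p * (of_nat (n choose k) * a k * b (n - k))
        + q * pderiv (of_nat (n choose k) * a k * b (n - k)))"
    unfolding binomial_conv_Suc
  proof (intro sum.cong refl)
    fix k assume "k \<in> {..n}"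
    then have "of_nat n = of_nat k + (of_nat (n - k) :: 'a poly)"
      by (metis atMost_iff le_add_diff_inverse of_nat_add)
    \<comment> \<open>To be read with u = k, v = n-k, r the binomial coefficient, and f', g' the
      derivatives of f, g.\<close>
    moreover have "r * ((u * p * f + q * f' - c * f) * g + f * (v * p * g + q * g' + c * g)) =
        (u + v) * p * (r * f * g) + q * (r * (f * g' + g * f'))" for r u v f g f' g'
      by (simp add: algebra_simps)
    ultimately show "of_nat (n choose k) * (a (Suc k) * b (n - k) + a k * b (Suc (n - k))) =
        of_nat n * p * (of_nat (n choose k) * a k * b (n - k))
        + q * pderiv (of_nat (n choose k) * a k * b (n - k))"
      unfolding a b mult.assoc[of "of_nat (n choose k)"] d pderiv_mult[of "a k"]
      by (simp only:) (simp only: mult.assoc)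
  qed
  then show ?thesis
    by (simp add: binomial_conv_def sum.distrib sum_distrib_left pderiv_sum)
qed

section \<open>The reciprocal sequence and the recurrence for C\<close>

text \<open>The exceptional entry at 1 supplies the term n x C_(n-1), which stands outside the sum
  in the claim.\<close>

definition eulerian_cofactor :: "nat \<Rightarrow> int poly" where
  "eulerian_cofactor k =
     (if k = 0 then 1 else if k = 1 then - [:0, 1:] else - second_eulerian_poly (k - 1))"

text \<open>For k > 1 this is the recurrence for C with the index lowered by one, since 2(k-1)+1 =
  2k-1. The factor is written as 2k x - x to separate the part proportional to k.\<close>

lemma eulerian_cofactor_Suc:
  fixes X :: "int poly"
  assumes X: "X = [:0, 1:]"
  shows "eulerian_cofactor (Suc k) =
    of_nat k * (2 * X) * eulerian_cofactor k + X * (1 - X) * pderiv (eulerian_cofactor k)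
    - X * eulerian_cofactor k"
proof -
  have pX: "pderiv X = 1" by (simp add: X pderiv_pCons)
  consider "k = 0" | "k = 1" | j where "k = Suc (Suc j)"
    by (metis One_nat_def not0_implies_Suc)
  then show ?thesis
  proof cases
    case 1
    then show ?thesis by (simp add: eulerian_cofactor_def flip: X)
  next
    case 2
    have "second_eulerian_poly (Suc 0) = X"
      using second_eulerian_poly_Suc[OF X, of 0] by (simp add: second_eulerian_poly_0)
    then show ?thesis
      using 2 by (simp add: eulerian_cofactor_def pderiv_minus pX algebra_simps flip: X)
  next
    case 3
    then show ?thesis
      using second_eulerian_poly_Suc[OF X, of "Suc j"]
      by (simp add: eulerian_cofactor_def pderiv_minus algebra_simps)
  qed
qed

lemma binomial_conv_eulerian_cofactor:
  "binomial_conv eulerian_cofactor second_eulerian_poly (Suc n) = 0"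
proof -
  define X :: "int poly" where "X = [:0, 1:]"
  let ?h = "binomial_conv eulerian_cofactor second_eulerian_poly"
  \<comment> \<open>With p = 2x and c = x, the factor (2k+1) x for C is k p + c, and (2k-1) x for
    the cofactor is k p - c.\<close>
  have h: "?h (Suc n) = of_nat n * (2 * X) * ?h n + X * (1 - X) * pderiv (?h n)" for n
    by (rule binomial_conv_pderiv_recurrence[where c = X])
      (use X_def in \<open>simp_all add: eulerian_cofactor_Suc second_eulerian_poly_Suc[OF X_def]
        algebra_simps del: mult_pCons_left mult_pCons_right\<close>)
  have "?h 0 = 1" by (simp add: binomial_conv_def eulerian_cofactor_def second_eulerian_poly_0)
  \<comment> \<open>At the base both the factor 0 and the derivative of the constant 1 vanish;
    afterwards the recurrence is homogeneous.\<close>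
  then show ?thesis by (induction n) (simp_all add: h)
qed

lemma second_eulerian_poly_recurrence:
  assumes "n \<ge> 1"
  shows "second_eulerian_poly n =
           of_nat n * [:0, 1:] * second_eulerian_poly (n - 1)
           + (\<Sum>r = 1..n - 1. of_nat (n choose (n - r + 1))
                * second_eulerian_poly (n - r) * second_eulerian_poly (r - 1))"
proof -
  let ?C = second_eulerian_poly and ?f = "\<lambda>k. of_nat (n choose k) * eulerian_cofactor k
    * second_eulerian_poly (n - k)"
  let ?P = "of_nat n * [:0, 1:] * ?C (n - 1)"
    and ?S = "\<Sum>r = 1..n - 1. of_nat (n choose (n - r + 1)) * ?C (n - r) * ?C (r - 1)"
  have "{..n} = insert 0 (insert 1 {2..n})" using assms by auto
  then have "(\<Sum>k\<le>n. ?f k) = ?f 0 + (?f 1 + (\<Sum>k = 2..n. ?f k))" by simp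
  moreover have "(\<Sum>k\<le>n. ?f k) = 0"
    using binomial_conv_eulerian_cofactor[of "n - 1"] assms by (simp add: binomial_conv_def)
  moreover have "?f 0 = ?C n" "?f 1 = - ?P"
    by (simp_all add: eulerian_cofactor_def)
  \<comment> \<open>Substituting k = n-r+1 gives k-1 = n-r and n-k = r-1, and the range 2..n becomes
    1..n-1.\<close>
  moreover have "(\<Sum>k = 2..n. ?f k) = - ?S"
    unfolding sum_negf[symmetric]
    by (rule sum.reindex_bij_witness[of _ "\<lambda>r. n - r + 1" "\<lambda>k. n + 1 - k"])
      (auto simp: eulerian_cofactor_def)
  ultimately have "?C n + (- ?P + - ?S) = 0" by (simp only:)
  then have "?C n = - (- ?P + - ?S)" by (simp only: eq_neg_iff_add_eq_0)
  then show ?thesis by (simp only: minus_add_distrib minus_minus)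
qed

section \<open>Specialisation at x = 1\<close>

lemma double_fact_step:
  assumes "k \<ge> 1"
  shows "double_fact k = k * double_fact (k - 2)"
proof -
  have "{i \<in> {1..k}. even (k - i)} = insert k {i \<in> {1..k - 2}. even (k - 2 - i)}" (is "?A = insert k ?B")
  proof -
    \<comment> \<open>Parity excludes i = k-1.\<close>
    have "i \<le> k - 2" if "i \<le> k" "even (k - i)" "i \<noteq> k" for i
      using that by presburger
    then show ?thesis using assms by auto
  qed
  moreover have "finite ?B" "k \<notin> ?B"
    by (auto intro: finite_subset[of _ "{1..k - 2}"])
  ultimately show ?thesis by (simp add: double_fact_def)
qed

text \<open>At x = 1 the factor 1-x removes the derivative term, which leaves C_(n+1)(1) = (2n+1)
  C_n(1).\<close>

lemma poly_second_eulerian_poly_1: "poly (second_eulerian_poly n) 1 = double_fact (2 * int n - 1)"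
proof (induction n)
  case 0
  then show ?case by (simp add: second_eulerian_poly_0 double_fact_def)
next
  case (Suc n)
  have "double_fact (2 * int (Suc n) - 1) = (2 * int n + 1) * double_fact (2 * int n - 1)"
    using double_fact_step[of "1 + 2 * int n"] by simp
  then show ?case
    using Suc by (simp add: second_eulerian_poly_Suc[OF refl] of_nat_poly add.commute)
qed

theorem theorem2p1:
  fixes n :: nat
  assumes "n \<ge> 1"
  shows "second_eulerian_poly n =
           of_nat n * [:0, 1:] * second_eulerian_poly (n - 1)
           + (\<Sum>r = 1..n - 1. of_nat (n choose (n - r + 1))
                * second_eulerian_poly (n - r) * second_eulerian_poly (r - 1))
       \<and> double_fact (2 * int n - 1) =
           int n * double_fact (2 * int n - 3)
           + (\<Sum>r = 1..n - 1. int (n choose (n - r + 1))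
                * double_fact (2 * int n - 2 * int r - 1) * double_fact (2 * int r - 3))"
proof
  show *: "second_eulerian_poly n =
           of_nat n * [:0, 1:] * second_eulerian_poly (n - 1)
           + (\<Sum>r = 1..n - 1. of_nat (n choose (n - r + 1))
                * second_eulerian_poly (n - r) * second_eulerian_poly (r - 1))"
    using assms by (rule second_eulerian_poly_recurrence)
  \<comment> \<open>The bound on \<open>r\<close> turns natural subtraction into integer
    subtraction. Keeping \<open>m\<close> general also covers the index r-1, with \<open>r\<close>
    in place of \<open>m\<close> and 1 in place of \<open>r\<close>.\<close>
  have at1: "poly (second_eulerian_poly (m - r)) 1 = double_fact (2 * int m - 2 * int r - 1)"
    if "r \<le> m" for m r
    using that by (simp add: poly_second_eulerian_poly_1 of_nat_diff algebra_simps)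
  have "double_fact (2 * int n - 1) = poly (second_eulerian_poly n) 1"
    by (simp add: poly_second_eulerian_poly_1)
  also have "\<dots> = int n * double_fact (2 * int n - 3)
      + (\<Sum>r = 1..n - 1. int (n choose (n - r + 1))
          * double_fact (2 * int n - 2 * int r - 1) * double_fact (2 * int r - 3))"
    using assms at1[of 1 n]
    by (subst *) (auto simp: poly_sum of_nat_poly at1 intro!: sum.cong)
  finally show "double_fact (2 * int n - 1) =
           int n * double_fact (2 * int n - 3)
           + (\<Sum>r = 1..n - 1. int (n choose (n - r + 1))
                * double_fact (2 * int n - 2 * int r - 1) * double_fact (2 * int r - 3))" .
qed

end
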